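(* Let $K$ be a finite-dimensional simplicial complex. Then $|\hat K^\infty|$ strongly deformation retracts onto $|e(K^\flat)|$. Moreover, the deformation retraction can be chosen so that for each $n$ and every subcomplex $L$ of $K$ such that $\dim L\le n$, it moves $|\hat L^n|$ only within itself.
   Context: Simplicial complexes may be infinite but have finite simplexes. For a simplicial complex $K$, $|K|$ denotes its geometric realization with the metric topology, i.e. the topology of the metric $d(x,y)=\sum_v|x_v-y_v|$ in barycentric coordinates. The order complex of a poset $P$ is the simplicial complex whose vertices are the elements of $P$ and whose simplexes are the finite chains of $P$. $FP(K)$ is the poset of all nonempty simplexes of $K$ ordered by inclusion; the barycentric subdivision $K^\flat$ is the order complex of $FP(K)$. $[n]=\{0,\dots,n\}$ and $\mathbb N=\{0,1,\dots\}$ are posets with the usual linear order, and products of posets carry the product order. $\hat K^\infty$ is the subcomplex of the order complex of $FP(K)\times\mathbb N$ consisting of those chains on which the projection to $\mathbb N$ is injective (i.e. chains $(\sigma_0,j_0),\dots,(\sigma_k,j_k)$ with $\sigma_0\subseteq\dots\subseteq\sigma_k$ and $j_0<\dots<j_k$). $\hat K^n$ is the subcomplex of $\hat K^\infty$ consisting of the chains that lie in $FP(K)\times[n]$. For a subcomplex $L$ of $K$, $\hat L^n$ is a subcomplex of $\hat K^\infty$. The simplicial embedding $e:K^\flat\to\hat K^\infty$ is given on vertices by $\sigma\mapsto(\sigma,\dim\sigma)$. A strong deformation retraction of a space $Z$ onto $A\subset Z$ is a homotopy $h_t:Z\to Z$, $t\in[0,1]$, with $h_0=\mathrm{id}$,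 $h_1$ a retraction onto $A$, and $h_t|_A=\mathrm{id}_A$ for all $t$. It moves $B\subset Z$ (only) within itself if $h_t(B)\subset B$ for all $t$. *)

theory Defs
  imports "HOL-Analysis.Analysis" "HOL-Library.Product_Order"
begin

text \<open>
  Abstract simplicial complexes, possibly infinite, with finite simplexes. The empty simplex is
  allowed but not required to belong to a complex; it does not affect any notion below.
\<close>

definition abstract_complex :: "'v set set \<Rightarrow> bool" where
  "abstract_complex K \<longleftrightarrow>
     (\<forall>\<sigma>\<in>K. finite \<sigma>) \<and> (\<forall>\<sigma>\<in>K. \<forall>\<tau>. \<tau> \<subseteq> \<sigma> \<and> \<tau> \<noteq> {} \<longrightarrow> \<tau> \<in> K)"

definition subcomplex :: "'v set set \<Rightarrow> 'v set set \<Rightarrow> bool" where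
  "subcomplex L K \<longleftrightarrow> abstract_complex L \<and> L \<subseteq> K"

definition face_poset :: "'v set set \<Rightarrow> 'v set set" where
  "face_poset K = {\<sigma>\<in>K. \<sigma> \<noteq> {}}"

text \<open>Only applied to nonempty simplexes, so the truncated subtraction is harmless.\<close>

definition simplex_dim :: "'v set \<Rightarrow> nat" where
  "simplex_dim \<sigma> = card \<sigma> - 1"

definition dim_at_most :: "'v set set \<Rightarrow> nat \<Rightarrow> bool" where
  "dim_at_most K n \<longleftrightarrow> (\<forall>\<sigma>\<in>face_poset K. simplex_dim \<sigma> \<le> n)"

definition finite_dimensional :: "'v set set \<Rightarrow> bool" where
  "finite_dimensional K \<longleftrightarrow> (\<exists>n. dim_at_most K n)"


text \<open>
  A point of the realization is its family of barycentric coordinates, extended by zero to the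
  whole type of vertices. Thus the realization of a subcomplex is literally a subset of the
  realization of the complex.
\<close>

definition coord_support :: "('v \<Rightarrow> real) \<Rightarrow> 'v set" where
  "coord_support x = {v. x v \<noteq> 0}"

definition realization :: "'v set set \<Rightarrow> ('v \<Rightarrow> real) set" where
  "realization K =
     {x. (\<forall>v. 0 \<le> x v) \<and> coord_support x \<in> K \<and> (\<Sum>v\<in>coord_support x. x v) = 1}"

definition bary_dist :: "('v \<Rightarrow> real) \<Rightarrow> ('v \<Rightarrow> real) \<Rightarrow> real" where
  "bary_dist x y = (\<Sum>v\<in>coord_support x \<union> coord_support y. \<bar>x v - y v\<bar>)"

definition realization_topology :: "'v set set \<Rightarrow> ('v \<Rightarrow> real) topology" where
  "realization_topology K = Metric_space.mtopology (realization K) bary_dist"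

lemma bary_dist_eq_sum:
  assumes "finite S" "coord_support x \<subseteq> S" "coord_support y \<subseteq> S"
  shows "bary_dist x y = (\<Sum>v\<in>S. \<bar>x v - y v\<bar>)"
  unfolding bary_dist_def
  by (rule sum.mono_neutral_left) (use assms in \<open>auto simp: coord_support_def\<close>)

lemma Metric_space_realization:
  assumes "abstract_complex K"
  shows "Metric_space (realization K) bary_dist"
proof
  have fin: "finite (coord_support x)" if "x \<in> realization K" for x
    using that assms by (auto simp: realization_def abstract_complex_def)
  show "0 \<le> bary_dist x y" for x y :: "'a \<Rightarrow> real"
    by (simp add: bary_dist_def sum_nonneg)
  show "bary_dist x y = bary_dist y x" for x y :: "'a \<Rightarrow> real"
    by (simp add: bary_dist_def abs_minus_commute Un_commute)
  show "bary_dist x y = 0 \<longleftrightarrow> x = y" if "x \<in> realization K" "y \<in> realization K" for x y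
  proof
    assume "bary_dist x y = 0"
    then have *: "x v = y v" if "v \<in> coord_support x \<union> coord_support y" for v
      using that fin[OF \<open>x \<in> _\<close>] fin[OF \<open>y \<in> _\<close>]
      by (auto simp: bary_dist_def sum_nonneg_eq_0_iff)
    show "x = y"
    proof
      fix v show "x v = y v"
        using *[of v] by (cases "v \<in> coord_support x \<union> coord_support y")
          (auto simp: coord_support_def)
    qed
  qed (simp add: bary_dist_def)
  show "bary_dist x z \<le> bary_dist x y + bary_dist y z"
    if "x \<in> realization K" "y \<in> realization K" "z \<in> realization K" for x y z
  proof -
    let ?S = "coord_support x \<union> coord_support y \<union> coord_support z"
    have S: "finite ?S"
      using that fin by blast
    have "(\<Sum>v\<in>?S. \<bar>x v - z v\<bar>) \<le> (\<Sum>v\<in>?S. \<bar>x v - y v\<bar> + \<bar>y v - z v\<bar>)"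
      by (rule sum_mono) linarith
    then show ?thesis
      using S by (simp add: bary_dist_eq_sum[of ?S] sum.distrib le_supI1)
  qed
qed

lemma topspace_realization_topology:
  assumes "abstract_complex K"
  shows "topspace (realization_topology K) = realization K"
proof -
  interpret Metric_space "realization K" bary_dist
    by (rule Metric_space_realization[OF assms])
  show ?thesis
    by (simp add: realization_topology_def)
qed


text \<open>
  Below, sets of simplexes are ordered by inclusion and pairs by the componentwise order of
  \<open>HOL-Library.Product_Order\<close>.
\<close>

definition order_complex :: "'p::order set \<Rightarrow> 'p set set" where
  "order_complex P = {c. finite c \<and> c \<subseteq> P \<and> Complete_Partial_Order.chain (\<le>) c}"

definition barycentric :: "'v set set \<Rightarrow> 'v set set set" where
  "barycentric K = order_complex (face_poset K)"

definition hat_inf :: "'v set set \<Rightarrow> ('v set \<times> nat) set set" where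
  "hat_inf K = {c \<in> order_complex (face_poset K \<times> UNIV). inj_on snd c}"

definition hat :: "'v set set \<Rightarrow> nat \<Rightarrow> ('v set \<times> nat) set set" where
  "hat K n = {c \<in> hat_inf K. c \<subseteq> face_poset K \<times> {0..n}}"

definition dim_vertex :: "'v set \<Rightarrow> 'v set \<times> nat" where
  "dim_vertex \<sigma> = (\<sigma>, simplex_dim \<sigma>)"

definition dim_embedding_image :: "'v set set \<Rightarrow> ('v set \<times> nat) set set" where
  "dim_embedding_image K = (\<lambda>c. dim_vertex ` c) ` barycentric K"

lemma abstract_complex_order_complex: "abstract_complex (order_complex P)"
  by (auto simp: abstract_complex_def order_complex_def chain_def
      intro: finite_subset)

lemma abstract_complex_hat_inf: "abstract_complex (hat_inf K)"
  using abstract_complex_order_complex[of "face_poset K \<times> (UNIV :: nat set)"]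
  by (auto simp: abstract_complex_def hat_inf_def intro: inj_on_subset)

lemma subcomplex_hat:
  assumes "subcomplex L K"
  shows "subcomplex (hat L n) (hat_inf K)"
proof -
  have "abstract_complex (hat L n)"
    using abstract_complex_hat_inf[of L] by (auto simp: abstract_complex_def hat_def)
  moreover have "hat L n \<subseteq> hat_inf K"
    using assms
    by (fastforce simp: hat_def hat_inf_def order_complex_def face_poset_def subcomplex_def)
  ultimately show ?thesis
    by (simp add: subcomplex_def)
qed

lemma subcomplex_dim_embedding_image:
  assumes "abstract_complex K"
  shows "subcomplex (dim_embedding_image K) (hat_inf K)"
proof -
  have bary: "abstract_complex (barycentric K)"
    unfolding barycentric_def by (rule abstract_complex_order_complex)
  have "abstract_complex (dim_embedding_image K)"
    unfolding abstract_complex_def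
  proof (intro conjI ballI allI impI)
    fix s assume "s \<in> dim_embedding_image K"
    then show "finite s"
      using bary by (auto simp: dim_embedding_image_def abstract_complex_def)
  next
    fix s t assume "s \<in> dim_embedding_image K" "t \<subseteq> s \<and> t \<noteq> {}"
    then obtain c where c: "c \<in> barycentric K" "t \<subseteq> dim_vertex ` c" "t \<noteq> {}"
      by (auto simp: dim_embedding_image_def)
    then obtain c' where "c' \<subseteq> c" "t = dim_vertex ` c'"
      by (meson subset_imageE)
    with c bary show "t \<in> dim_embedding_image K"
      by (auto simp: dim_embedding_image_def abstract_complex_def)
  qed
  moreover have "dim_vertex ` c \<in> hat_inf K" if c: "c \<in> barycentric K" for c
  proof -
    have fin: "finite \<sigma>" "card \<sigma> \<noteq> 0" if "\<sigma> \<in> c" for \<sigma>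
      using c that assms
      by (auto simp: barycentric_def order_complex_def face_poset_def abstract_complex_def)
    have cmp: "\<sigma> \<subseteq> \<tau> \<or> \<tau> \<subseteq> \<sigma>" if "\<sigma> \<in> c" "\<tau> \<in> c" for \<sigma> \<tau>
      using c that by (auto simp: barycentric_def order_complex_def chain_def)
    have mono: "simplex_dim \<sigma> \<le> simplex_dim \<tau>" if "\<tau> \<in> c" "\<sigma> \<subseteq> \<tau>" for \<sigma> \<tau>
      using card_mono[OF fin(1)[OF that(1)] that(2)] by (simp add: simplex_dim_def)
    have eq: "\<sigma> = \<tau>" if "\<sigma> \<in> c" "\<tau> \<in> c" "simplex_dim \<sigma> = simplex_dim \<tau>" for \<sigma> \<tau>
    proof -
      have "card \<sigma> = card \<tau>"
        using that fin(2)[of \<sigma>] fin(2)[of \<tau>] by (simp add: simplex_dim_def)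
      then show ?thesis
        using cmp[OF that(1,2)] fin(1) that(1,2) card_subset_eq by metis
    qed
    have "inj_on snd (dim_vertex ` c)"
      using eq by (auto simp: inj_on_def dim_vertex_def)
    moreover have "Complete_Partial_Order.chain (\<le>) (dim_vertex ` c)"
      unfolding chain_def dim_vertex_def less_eq_prod_def using cmp mono
      by (metis (no_types, lifting) fst_conv imageE snd_conv)
    ultimately show ?thesis
      using c by (auto simp: hat_inf_def order_complex_def barycentric_def dim_vertex_def)
  qed
  ultimately show ?thesis
    by (auto simp: subcomplex_def dim_embedding_image_def)
qed


definition strong_deformation_retraction ::
    "'z topology \<Rightarrow> 'z set \<Rightarrow> (real \<times> 'z \<Rightarrow> 'z) \<Rightarrow> bool" where
  "strong_deformation_retraction Z A h \<longleftrightarrow>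
     A \<subseteq> topspace Z \<and>
     continuous_map (prod_topology (top_of_set {0..1}) Z) Z h \<and>
     (\<forall>x\<in>topspace Z. h (0, x) = x) \<and>
     retraction_maps Z (subtopology Z A) (\<lambda>x. h (1, x)) id \<and>
     (\<forall>t\<in>{0..1}. \<forall>x\<in>A. h (t, x) = x)"

definition moves_within_itself :: "(real \<times> 'z \<Rightarrow> 'z) \<Rightarrow> 'z set \<Rightarrow> bool" where
  "moves_within_itself h B \<longleftrightarrow> (\<forall>t\<in>{0..1}. \<forall>x\<in>B. h (t, x) \<in> B)"

end

theory Submission
  imports Defs
begin

text \<open>
  The deformation retraction is a finite concatenation of straight-line homotopies, each given by a
  vertex map that is contiguous to the identity. Call \<open>j\<close> the level of a vertex \<open>(\<sigma>, j)\<close>; the aim is to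
  bring every vertex to the level \<open>dim \<sigma>\<close>. A vertex may be moved from \<open>(\<sigma>, j)\<close> to \<open>(\<sigma>, dim \<sigma>)\<close> along
  straight lines as soon as adding the new vertex to any simplex containing the old one gives a
  simplex again, that is, a chain with injective levels. What could go wrong is that a larger \<open>\<tau>\<close>
  sits at a level \<open>\<le> dim \<sigma>\<close> or a smaller \<open>\<rho>\<close> at a level \<open>\<ge> dim \<sigma>\<close>. Handling the dimensions one at a time
  in the right order prevents this:

  \<^item> First the vertices that are too low are raised, in order of decreasing dimension \<open>i\<close>. When
    \<open>(\<sigma>, j)\<close> with \<open>j < i = dim \<sigma>\<close> moves up to \<open>(\<sigma>, i)\<close>, the larger \<open>\<tau>\<close> in the chain have already been raised,
    so their levels are \<open>\<ge> dim \<tau> > i\<close>, while smaller \<open>\<rho>\<close> lie at levels \<open>< j < i\<close>.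
  \<^item> Then the vertices, which now all have level at least their dimension, are lowered, in order of
    increasing dimension \<open>i\<close>. When \<open>(\<sigma>, j)\<close> with \<open>j > i = dim \<sigma>\<close> moves down to \<open>(\<sigma>, i)\<close>, the smaller \<open>\<rho>\<close> in
    the chain are already at level \<open>dim \<rho> < i\<close>, and the larger \<open>\<tau>\<close> have level \<open>\<ge> dim \<tau> > i\<close>.

  Finite-dimensionality makes the number of stages finite. A stage introduces only vertices
  \<open>(\<sigma>, dim \<sigma>)\<close> over simplexes \<open>\<sigma>\<close> that already occur, so it preserves the realization of \<open>hat L n\<close>
  whenever \<open>dim L \<le> n\<close>, and it does not move the vertices \<open>(\<sigma>, dim \<sigma>)\<close>.

  Continuity in the metric topology costs nothing: pushing mass forward along a vertex map is
  1-Lipschitz for the \<open>\<ell>\<^sup>1\<close> distance, and therefore the straight-line homotopies are Lipschitz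
  (\<open>bary_dist_linear_homotopy_le\<close>). The combinatorial condition on one stage is isolated in the
  locale \<open>settling_stage\<close>, and stages are glued by \<open>deforms_within_trans\<close>.
\<close>

section \<open>Pushing mass forward along a vertex map\<close>

definition pushforward :: "('v \<Rightarrow> 'w) \<Rightarrow> ('v \<Rightarrow> real) \<Rightarrow> 'w \<Rightarrow> real" where
  "pushforward f x w = (\<Sum>v | v \<in> coord_support x \<and> f v = w. x v)"

lemma pushforward_eq_sum:
  assumes "finite S" "coord_support x \<subseteq> S"
  shows "pushforward f x w = (\<Sum>v | v \<in> S \<and> f v = w. x v)"
  unfolding pushforward_def
  by (rule sum.mono_neutral_left) (use assms in \<open>auto simp: coord_support_def\<close>)

lemma pushforward_nonneg: "(\<And>v. 0 \<le> x v) \<Longrightarrow> 0 \<le> pushforward f x w"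
  by (simp add: pushforward_def sum_nonneg)

lemma coord_support_pushforward: "coord_support (pushforward f x) \<subseteq> f ` coord_support x"
proof
  fix w assume "w \<in> coord_support (pushforward f x)"
  then have "{v. v \<in> coord_support x \<and> f v = w} \<noteq> {}"
    unfolding coord_support_def[of "pushforward f x"] pushforward_def
    by (metis (mono_tags, lifting) mem_Collect_eq sum.empty)
  then show "w \<in> f ` coord_support x"
    by auto
qed

lemma sum_eq_sum_coord_support:
  assumes "finite S" "coord_support x \<subseteq> S"
  shows "sum x S = sum x (coord_support x)"
  by (rule sum.mono_neutral_right) (use assms in \<open>auto simp: coord_support_def\<close>)

lemma sum_pushforward:
  assumes x: "finite (coord_support x)" and T: "finite T" "f ` coord_support x \<subseteq> T"
  shows "sum (pushforward f x) T = sum x (coord_support x)"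
proof -
  have "sum (pushforward f x) T = sum (pushforward f x) (f ` coord_support x)"
    using sum_eq_sum_coord_support[of T "pushforward f x"] coord_support_pushforward[of f x]
      sum_eq_sum_coord_support[of "f ` coord_support x" "pushforward f x"] x T
    by (metis finite_imageI order_trans)
  then show ?thesis
    using sum.image_gen[OF x, of x f] by (simp add: pushforward_def)
qed

lemma pushforward_ident:
  assumes "finite (coord_support x)" "\<And>v. v \<in> coord_support x \<Longrightarrow> f v = v"
  shows "pushforward f x = x"
proof
  fix w
  have "{v. v \<in> coord_support x \<and> f v = w} = (if w \<in> coord_support x then {w} else {})"
    using assms(2) by auto
  then show "pushforward f x w = x w"
    by (auto simp: pushforward_def coord_support_def)
qed

text \<open>
  Each fibre of \<open>f\<close> contributes the absolute value of a sum on the left and the sum of the absolute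
  values on the right.
\<close>

lemma bary_dist_pushforward_le:
  assumes "finite (coord_support x)" "finite (coord_support y)"
  shows "bary_dist (pushforward f x) (pushforward f y) \<le> bary_dist x y"
proof -
  let ?S = "coord_support x \<union> coord_support y"
  have S: "finite ?S" "coord_support x \<subseteq> ?S" "coord_support y \<subseteq> ?S"
    using assms by auto
  have "bary_dist (pushforward f x) (pushforward f y)
      = (\<Sum>w\<in>f ` ?S. \<bar>pushforward f x w - pushforward f y w\<bar>)"
    using S coord_support_pushforward[of f x] coord_support_pushforward[of f y]
    by (intro bary_dist_eq_sum) blast+
  also have "\<dots> = (\<Sum>w\<in>f ` ?S. \<bar>\<Sum>v | v \<in> ?S \<and> f v = w. x v - y v\<bar>)"
    by (simp only: pushforward_eq_sum[OF S(1,2)] pushforward_eq_sum[OF S(1,3)] sum_subtractf)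
  also have "\<dots> \<le> (\<Sum>w\<in>f ` ?S. \<Sum>v | v \<in> ?S \<and> f v = w. \<bar>x v - y v\<bar>)"
    by (intro sum_mono sum_abs)
  also have "\<dots> = bary_dist x y"
    using sum.image_gen[OF S(1), of "\<lambda>v. \<bar>x v - y v\<bar>" f] by (simp add: bary_dist_def)
  finally show ?thesis .
qed

text \<open>
  This is the straight line from \<open>x\<close> to its image under the simplicial map induced by \<open>f\<close>. It is
  defined on all coordinate families; whether it stays in a given complex depends on contiguity.
\<close>

definition linear_homotopy :: "('v \<Rightarrow> 'v) \<Rightarrow> real \<times> ('v \<Rightarrow> real) \<Rightarrow> 'v \<Rightarrow> real" where
  "linear_homotopy f = (\<lambda>(t, x) v. (1 - t) * x v + t * pushforward f x v)"

lemma linear_homotopy_0: "linear_homotopy f (0, x) = x"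
  by (simp add: linear_homotopy_def)

lemma linear_homotopy_1: "linear_homotopy f (1, x) = pushforward f x"
  by (simp add: linear_homotopy_def)

lemma linear_homotopy_ident:
  assumes "finite (coord_support x)" "\<And>v. v \<in> coord_support x \<Longrightarrow> f v = v"
  shows "linear_homotopy f (t, x) = x"
  by (auto simp: linear_homotopy_def pushforward_ident[OF assms] algebra_simps)

lemma coord_support_linear_homotopy:
  "coord_support (linear_homotopy f (t, x)) \<subseteq> coord_support x \<union> f ` coord_support x"
  using coord_support_pushforward[of f x]
  by (auto simp: linear_homotopy_def coord_support_def)

section \<open>Contiguous vertex maps and linear deformations\<close>

lemma finite_coord_support:
  "abstract_complex K \<Longrightarrow> x \<in> realization K \<Longrightarrow> finite (coord_support x)"
  by (auto simp: realization_def abstract_complex_def)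

lemma realizationI:
  assumes "abstract_complex K" "\<sigma> \<in> K" "\<And>v. 0 \<le> x v" "coord_support x \<subseteq> \<sigma>" "(\<Sum>v\<in>\<sigma>. x v) = 1"
  shows "x \<in> realization K"
proof -
  have "finite \<sigma>"
    using assms(1,2) by (simp add: abstract_complex_def)
  then have sum: "(\<Sum>v\<in>coord_support x. x v) = 1"
    using assms(4,5) sum_eq_sum_coord_support by metis
  then have "coord_support x \<noteq> {}"
    by (metis sum.empty zero_neq_one)
  then show ?thesis
    using assms sum by (auto simp: realization_def abstract_complex_def)
qed

lemma sum_realization:
  assumes "x \<in> realization K" "finite S" "coord_support x \<subseteq> S"
  shows "sum x S = 1"
  using assms sum_eq_sum_coord_support[of S x] by (simp add: realization_def)

lemma sum_pushforward_realization:
  assumes "abstract_complex K" "x \<in> realization K" "finite T" "f ` coord_support x \<subseteq> T"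
  shows "sum (pushforward f x) T = 1"
  using assms sum_pushforward[of x T f] finite_coord_support[of K x]
  by (simp add: realization_def)

lemma pushforward_in_realization:
  assumes "abstract_complex M" "abstract_complex N" "\<And>c. c \<in> M \<Longrightarrow> f ` c \<in> N"
    and "x \<in> realization M"
  shows "pushforward f x \<in> realization N"
proof (rule realizationI[OF assms(2)])
  have fin: "finite (coord_support x)"
    using assms finite_coord_support by blast
  show "f ` coord_support x \<in> N"
    using assms(3,4) by (simp add: realization_def)
  show "0 \<le> pushforward f x v" for v
    using assms(4) by (simp add: pushforward_nonneg realization_def)
  show "coord_support (pushforward f x) \<subseteq> f ` coord_support x"
    by (rule coord_support_pushforward)
  show "sum (pushforward f x) (f ` coord_support x) = 1"
    using sum_pushforward_realization[OF assms(1,4) finite_imageI[OF fin] order_refl] .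
qed

text \<open>
  The segment from \<open>x\<close> to its image lies in the single simplex spanned by the support \<open>c\<close> of \<open>x\<close> and \<open>f ` c\<close>.
  Applied to subcomplexes that are closed under \<open>c \<mapsto> c \<union> f ` c\<close>, this also shows that the homotopy
  moves them within themselves.
\<close>

lemma linear_homotopy_in_realization:
  assumes "abstract_complex M" "\<And>c. c \<in> M \<Longrightarrow> c \<union> f ` c \<in> M"
    and "x \<in> realization M" "t \<in> {0..1}"
  shows "linear_homotopy f (t, x) \<in> realization M"
proof (rule realizationI[OF assms(1)])
  let ?S = "coord_support x" and ?y = "pushforward f x"
  have fin: "finite ?S"
    using assms finite_coord_support by blast
  show "?S \<union> f ` ?S \<in> M"
    using assms(2,3) by (simp add: realization_def)
  show "0 \<le> linear_homotopy f (t, x) v" for v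
    using assms(3,4) pushforward_nonneg[of x f v]
    by (simp add: linear_homotopy_def realization_def)
  show "coord_support (linear_homotopy f (t, x)) \<subseteq> ?S \<union> f ` ?S"
    by (rule coord_support_linear_homotopy)
  have "sum ?y (?S \<union> f ` ?S) = 1"
    using fin by (intro sum_pushforward_realization[OF assms(1,3)]) auto
  moreover have "sum x (?S \<union> f ` ?S) = 1"
    using fin by (intro sum_realization[OF assms(3)]) auto
  ultimately show "sum (linear_homotopy f (t, x)) (?S \<union> f ` ?S) = 1"
    by (simp add: linear_homotopy_def sum.distrib flip: sum_distrib_left)
qed

text \<open>
  For a fixed time the homotopy is a convex combination of two 1-Lipschitz maps; for a fixed point it
  runs along a segment whose endpoints have mass 1, hence with speed at most 2.
\<close>

lemma bary_dist_linear_homotopy_le: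
  assumes K: "abstract_complex K" and x: "x \<in> realization K" and y: "y \<in> realization K"
    and t: "t \<in> {0..1}"
  shows "bary_dist (linear_homotopy f (s, x)) (linear_homotopy f (t, y))
           \<le> bary_dist x y + 2 * \<bar>s - t\<bar>"
proof -
  let ?T = "coord_support x \<union> coord_support y"
  let ?S = "?T \<union> f ` ?T"
  let ?x = "pushforward f x" and ?y = "pushforward f y"
  have fin: "finite (coord_support x)" "finite (coord_support y)"
    using finite_coord_support[OF K] x y by auto
  have S: "finite ?S" "coord_support x \<subseteq> ?S" "coord_support y \<subseteq> ?S"
    using fin by auto
  have pS: "coord_support ?x \<subseteq> ?S" "coord_support ?y \<subseteq> ?S"
    by (rule order_trans[OF coord_support_pushforward], blast)+
  have nonneg: "0 \<le> x v" "0 \<le> ?x v" for v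
    using x by (auto simp: realization_def pushforward_nonneg)
  have sum_x: "sum x ?S = 1"
    by (rule sum_realization[OF x S(1,2)])
  have sum_px: "sum ?x ?S = 1"
    by (rule sum_pushforward_realization[OF K x S(1)]) auto
  have "bary_dist (linear_homotopy f (s, x)) (linear_homotopy f (t, y))
      = (\<Sum>v\<in>?S. \<bar>linear_homotopy f (s, x) v - linear_homotopy f (t, y) v\<bar>)"
  proof (rule bary_dist_eq_sum[OF S(1)])
    show "coord_support (linear_homotopy f (s, x)) \<subseteq> ?S"
      by (rule order_trans[OF coord_support_linear_homotopy]) auto
    show "coord_support (linear_homotopy f (t, y)) \<subseteq> ?S"
      by (rule order_trans[OF coord_support_linear_homotopy]) auto
  qed
  also have "\<dots> \<le> (\<Sum>v\<in>?S. (1 - t) * \<bar>x v - y v\<bar> + t * \<bar>?x v - ?y v\<bar>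
                     + \<bar>s - t\<bar> * x v + \<bar>s - t\<bar> * ?x v)"
  proof (rule sum_mono)
    fix v
    have "linear_homotopy f (s, x) v - linear_homotopy f (t, y) v
        = (1 - t) * (x v - y v) + t * (?x v - ?y v) - (s - t) * x v + (s - t) * ?x v"
      by (simp add: linear_homotopy_def algebra_simps)
    also have "\<bar>\<dots>\<bar> \<le> \<bar>(1 - t) * (x v - y v)\<bar> + \<bar>t * (?x v - ?y v)\<bar>
                   + \<bar>(s - t) * x v\<bar> + \<bar>(s - t) * ?x v\<bar>"
      by linarith
    finally show "\<bar>linear_homotopy f (s, x) v - linear_homotopy f (t, y) v\<bar>
        \<le> (1 - t) * \<bar>x v - y v\<bar> + t * \<bar>?x v - ?y v\<bar> + \<bar>s - t\<bar> * x v + \<bar>s - t\<bar> * ?x v"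
      using t nonneg[of v] by (simp add: abs_mult)
  qed
  also have "\<dots> = (1 - t) * bary_dist x y + t * bary_dist ?x ?y + \<bar>s - t\<bar> + \<bar>s - t\<bar>"
    using sum_x sum_px bary_dist_eq_sum[OF S] bary_dist_eq_sum[OF S(1) pS]
    by (simp add: sum.distrib flip: sum_distrib_left)
  also have "\<dots> \<le> (1 - t) * bary_dist x y + t * bary_dist x y + \<bar>s - t\<bar> + \<bar>s - t\<bar>"
    using t bary_dist_pushforward_le[OF fin, of f] by (simp add: mult_left_mono)
  finally show ?thesis
    by (simp add: algebra_simps)
qed

lemma continuous_map_linear_homotopy:
  assumes K: "abstract_complex K" and closed: "\<And>c. c \<in> K \<Longrightarrow> c \<union> f ` c \<in> K"
  shows "continuous_map (prod_topology (top_of_set {0..1}) (realization_topology K))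
           (realization_topology K) (linear_homotopy f)"
proof -
  interpret Metric_space "realization K" bary_dist
    by (rule Metric_space_realization[OF K])
  let ?X = "prod_topology (top_of_set {0..1::real}) mtopology"
  have "continuous_map ?X mtopology (linear_homotopy f)"
    unfolding continuous_map_to_metric
  proof (intro ballI allI impI)
    fix p \<epsilon> assume p: "p \<in> topspace ?X" and \<epsilon>: "(0::real) < \<epsilon>"
    obtain t x where [simp]: "p = (t, x)" and t: "t \<in> {0..1}" and x: "x \<in> realization K"
      using p by auto
    let ?U = "({0..1} \<inter> ball t (\<epsilon> / 3)) \<times> mball x (\<epsilon> / 3)"
    have "openin ?X ?U"
      by (auto simp: openin_prod_Times_iff openin_open)
    moreover have "p \<in> ?U"
      using t x \<epsilon> by simp
    moreover have "linear_homotopy f q \<in> mball (linear_homotopy f p) \<epsilon>" if q: "q \<in> ?U" for q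
    proof -
      obtain s y where [simp]: "q = (s, y)" and s: "s \<in> {0..1}" "\<bar>t - s\<bar> < \<epsilon> / 3"
        and y: "y \<in> realization K" "bary_dist x y < \<epsilon> / 3"
        using q by (auto simp: dist_real_def)
      have "bary_dist (linear_homotopy f (t, x)) (linear_homotopy f (s, y)) < \<epsilon>"
      proof -
        have "bary_dist (linear_homotopy f (t, x)) (linear_homotopy f (s, y))
            \<le> bary_dist x y + 2 * \<bar>t - s\<bar>"
          by (rule bary_dist_linear_homotopy_le[OF K x y(1) s(1)])
        also have "\<dots> < \<epsilon> / 3 + 2 * (\<epsilon> / 3)"
          using s(2) y(2) by (intro add_strict_mono) auto
        finally show ?thesis
          by simp
      qed
      then show ?thesis
        using linear_homotopy_in_realization[OF K closed] s t x y by simp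
    qed
    ultimately show "\<exists>U. openin ?X U \<and> p \<in> U \<and>
        (\<forall>q\<in>U. linear_homotopy f q \<in> mball (linear_homotopy f p) \<epsilon>)"
      by blast
  qed
  then show ?thesis
    by (simp add: realization_topology_def)
qed

lemma realization_mono: "L \<subseteq> K \<Longrightarrow> realization L \<subseteq> realization K"
  by (auto simp: realization_def)

lemma realization_Int: "realization (K \<inter> L) = realization K \<inter> realization L"
  by (auto simp: realization_def)

text \<open>
  A retract reached by one stage is the space on which the next stage starts; this identifies the
  two topologies on it.
\<close>

lemma realization_topology_subcomplex:
  assumes "abstract_complex K" "L \<subseteq> K"
  shows "realization_topology L = subtopology (realization_topology K) (realization L)"
proof -
  interpret Submetric "realization K" bary_dist "realization L"
    using Metric_space_realization[OF assms(1)] realization_mono[OF assms(2)]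
    by (simp add: Submetric_def Submetric_axioms_def)
  show ?thesis
    by (simp add: realization_topology_def mtopology_submetric)
qed

lemma strong_deformation_retraction_linear_homotopy:
  assumes M: "abstract_complex M" and N: "subcomplex N M"
    and contiguous: "\<And>c. c \<in> M \<Longrightarrow> c \<union> f ` c \<in> M"
    and into: "\<And>c. c \<in> M \<Longrightarrow> f ` c \<in> N"
    and fixes_N: "\<And>c v. c \<in> N \<Longrightarrow> v \<in> c \<Longrightarrow> f v = v"
  shows "strong_deformation_retraction (realization_topology M) (realization N)
           (linear_homotopy f)"
proof -
  let ?Z = "realization_topology M"
  have top: "topspace ?Z = realization M"
    by (rule topspace_realization_topology[OF M])
  have N': "abstract_complex N" "N \<subseteq> M"
    using N by (auto simp: subcomplex_def)
  have sub: "realization N \<subseteq> realization M"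
    using N' by (intro realization_mono)
  have cont: "continuous_map (prod_topology (top_of_set {0..1}) ?Z) ?Z (linear_homotopy f)"
    by (rule continuous_map_linear_homotopy[OF M contiguous])
  have fix': "linear_homotopy f (t, x) = x" if "x \<in> realization N" for t x
    using that fixes_N finite_coord_support[OF N'(1) that]
    by (intro linear_homotopy_ident) (auto simp: realization_def)
  have "continuous_map ?Z (prod_topology (top_of_set {0..1}) ?Z) (\<lambda>x. (1::real, x))"
    by (auto simp: continuous_map_pairedI)
  then have "continuous_map ?Z ?Z (\<lambda>x. linear_homotopy f (1, x))"
    using continuous_map_compose[OF _ cont] by (simp add: o_def)
  then have "continuous_map ?Z (subtopology ?Z (realization N)) (\<lambda>x. linear_homotopy f (1, x))"
    using pushforward_in_realization[OF M N'(1) into]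
    by (auto simp: continuous_map_in_subtopology top linear_homotopy_1)
  then have "retraction_maps ?Z (subtopology ?Z (realization N))
      (\<lambda>x. linear_homotopy f (1, x)) id"
    using fix' by (auto simp: retraction_maps_def continuous_map_from_subtopology)
  then show ?thesis
    using cont fix' sub by (simp add: strong_deformation_retraction_def top linear_homotopy_0)
qed

section \<open>Concatenating deformation retractions\<close>

text \<open>
  The sets in \<open>\<B>\<close> are intersected with the space so that the same family can be used for every space in
  a descending sequence of retracts.
\<close>

definition deforms_within :: "'z topology \<Rightarrow> 'z set \<Rightarrow> 'z set set \<Rightarrow> bool" where
  "deforms_within Z A \<B> \<longleftrightarrow>
     (\<exists>h. strong_deformation_retraction Z A h \<and>
        (\<forall>B\<in>\<B>. moves_within_itself h (B \<inter> topspace Z)))"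

lemma deforms_within_refl: "deforms_within Z (topspace Z) \<B>"
  unfolding deforms_within_def
proof (intro exI conjI ballI)
  show "strong_deformation_retraction Z (topspace Z) snd"
    by (auto simp: strong_deformation_retraction_def retraction_maps_def continuous_map_snd
        intro: continuous_map_id[unfolded id_def])
qed (simp add: moves_within_itself_def)

text \<open>
  Run the first homotopy at double speed, and then the second one on the points that the first
  has brought into \<open>A\<close>.
\<close>

lemma deforms_within_trans:
  assumes "deforms_within Z A \<B>" "deforms_within (subtopology Z A) A' \<B>"
  shows "deforms_within Z A' \<B>"
proof -
  obtain h where h: "strong_deformation_retraction Z A h"
    and h_in: "\<And>B. B \<in> \<B> \<Longrightarrow> moves_within_itself h (B \<inter> topspace Z)"
    using assms(1) by (auto simp: deforms_within_def)
  obtain g where g: "strong_deformation_retraction (subtopology Z A) A' g"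
    and g_in: "\<And>B. B \<in> \<B> \<Longrightarrow> moves_within_itself g (B \<inter> topspace (subtopology Z A))"
    using assms(2) by (auto simp: deforms_within_def)
  let ?I = "top_of_set {0..1::real}" and ?A = "subtopology Z A"
  let ?X = "prod_topology ?I Z"
  have A: "A \<subseteq> topspace Z" "A' \<subseteq> A"
    using h g by (auto simp: strong_deformation_retraction_def)
  have ch: "continuous_map ?X Z h" and cg: "continuous_map (prod_topology ?I ?A) ?A g"
    using h g by (auto simp: strong_deformation_retraction_def)
  have ch1: "continuous_map Z ?A (\<lambda>x. h (1, x))"
    and cg1: "continuous_map ?A (subtopology ?A A') (\<lambda>x. g (1, x))"
    using h g by (auto simp: strong_deformation_retraction_def retraction_maps_def)
  have h0: "h (0, x) = x" if "x \<in> topspace Z" for x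
    using h that by (auto simp: strong_deformation_retraction_def)
  have g0: "g (0, x) = x" if "x \<in> A" for x
    using g A that by (auto simp: strong_deformation_retraction_def)
  have h_A: "h (t, x) = x" if "x \<in> A" "t \<in> {0..1}" for t x
    using h that by (auto simp: strong_deformation_retraction_def)
  have g_A': "g (t, x) = x" if "x \<in> A'" "t \<in> {0..1}" for t x
    using g that by (auto simp: strong_deformation_retraction_def)
  have h1: "h (1, x) \<in> A" if "x \<in> topspace Z" for x
    using ch1 that by (auto simp: continuous_map_in_subtopology)
  define k where "k = (\<lambda>p. if fst p \<le> 1/2 then h (2 * fst p, snd p)
                           else g (2 * fst p - 1, h (1, snd p)))"
  have "continuous_map ?X Z k"
    unfolding k_def
  proof (rule continuous_map_cases_le)
    have c_fst: "continuous_map (subtopology ?X S) euclideanreal fst" for S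
      by (metis continuous_map_from_subtopology continuous_map_fst continuous_map_into_fulltopology)
    show "continuous_map ?X euclideanreal fst" "continuous_map ?X euclideanreal (\<lambda>_. 1/2)"
      using c_fst[of UNIV] by auto
    have c_snd: "continuous_map (subtopology ?X S) Z snd" for S
      by (intro continuous_map_from_subtopology continuous_map_snd)
    let ?L = "{p \<in> topspace ?X. fst p \<le> 1/2}" and ?R = "{p \<in> topspace ?X. 1/2 \<le> fst p}"
    have "continuous_map (subtopology ?X ?L) ?X (\<lambda>p. (2 * fst p, snd p))"
      using c_fst c_snd
      by (auto intro!: continuous_map_pairedI continuous_map_real_mult
          simp: continuous_map_in_subtopology)
    then show "continuous_map (subtopology ?X ?L) Z (\<lambda>p. h (2 * fst p, snd p))"
      using continuous_map_compose[OF _ ch] by (simp add: o_def)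
    have "continuous_map (subtopology ?X ?R) ?A (\<lambda>p. h (1, snd p))"
      using continuous_map_compose[OF c_snd ch1] by (simp add: o_def)
    then have "continuous_map (subtopology ?X ?R) (prod_topology ?I ?A)
        (\<lambda>p. (2 * fst p - 1, h (1, snd p)))"
      using c_fst
      by (intro continuous_map_pairedI)
        (auto intro!: continuous_map_diff continuous_map_real_mult
          simp: continuous_map_in_subtopology)
    then have "continuous_map (subtopology ?X ?R) ?A (\<lambda>p. g (2 * fst p - 1, h (1, snd p)))"
      using continuous_map_compose[OF _ cg] by (simp add: o_def)
    then show "continuous_map (subtopology ?X ?R) Z (\<lambda>p. g (2 * fst p - 1, h (1, snd p)))"
      by (rule continuous_map_into_fulltopology)
    show "h (2 * fst p, snd p) = g (2 * fst p - 1, h (1, snd p))"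
      if "p \<in> topspace ?X" "fst p = 1/2" for p
      proof -
      have "p = (1/2, snd p)" "snd p \<in> topspace Z"
        using that by (auto simp: prod_eq_iff)
      then show ?thesis
        using h1 g0 by (metis (no_types, lifting) fst_conv cancel_comm_monoid_add_class.diff_cancel
            nonzero_eq_divide_eq mult.commute zero_neq_numeral)
    qed
  qed
  moreover have "retraction_maps Z (subtopology Z A') (\<lambda>x. k (1, x)) id"
  proof -
    have "continuous_map Z (subtopology ?A A') (\<lambda>x. g (1, h (1, x)))"
      using continuous_map_compose[OF ch1 cg1] by (simp add: o_def)
    then show ?thesis
      using A h_A g_A' by (auto simp: retraction_maps_def k_def subtopology_subtopology
          Int_absorb1 continuous_map_from_subtopology subset_iff)
  qed
  ultimately have "strong_deformation_retraction Z A' k"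
    using A h0 h_A g_A' by (auto simp: strong_deformation_retraction_def k_def subset_iff)
  moreover have "moves_within_itself k (B \<inter> topspace Z)" if B: "B \<in> \<B>" for B
    unfolding moves_within_itself_def
  proof (intro ballI)
    fix t :: real and x assume t: "t \<in> {0..1}" and x: "x \<in> B \<inter> topspace Z"
    have hB: "h (s, x) \<in> B \<inter> topspace Z" if "s \<in> {0..1}" for s
      using h_in[OF B] x that by (simp add: moves_within_itself_def)
    have "h (1, x) \<in> B \<inter> topspace ?A"
      using hB[of 1] h1 x A by auto
    then have gB: "g (s, h (1, x)) \<in> B \<inter> topspace ?A" if "s \<in> {0..1}" for s
      using g_in[OF B] that by (simp add: moves_within_itself_def)
    show "k (t, x) \<in> B \<inter> topspace Z"
      using hB[of "2 * t"] gB[of "2 * t - 1"] t by (auto simp: k_def)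
  qed
  ultimately show ?thesis
    by (auto simp: deforms_within_def)
qed

section \<open>Moving vertices of one dimension to their own level\<close>

definition hat_on :: "'v set set \<Rightarrow> ('v set \<times> nat) set \<Rightarrow> ('v set \<times> nat) set set" where
  "hat_on K P = {c \<in> hat_inf K. c \<subseteq> P}"

text \<open>
  \<open>Q\<close> is the set of vertices that are to stay in place.
\<close>

definition settle :: "('v set \<times> nat) set \<Rightarrow> 'v set \<times> nat \<Rightarrow> 'v set \<times> nat" where
  "settle Q v = (if v \<in> Q then v else dim_vertex (fst v))"

lemma abstract_complex_hat_on: "abstract_complex (hat_on K P)"
  using abstract_complex_hat_inf[of K] by (auto simp: abstract_complex_def hat_on_def)

lemma abstract_complex_Int:
  "abstract_complex K \<Longrightarrow> abstract_complex L \<Longrightarrow> abstract_complex (K \<inter> L)"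
  unfolding abstract_complex_def by (intro conjI ballI allI impI) (meson IntD1 IntD2 IntI)+

lemma simplex_dim_strict_mono:
  assumes "abstract_complex K" "\<tau> \<in> face_poset K" "\<sigma> \<in> face_poset K" "\<sigma> \<subset> \<tau>"
  shows "simplex_dim \<sigma> < simplex_dim \<tau>"
proof -
  have "finite \<sigma>" "finite \<tau>" "\<sigma> \<noteq> {}"
    using assms by (auto simp: face_poset_def abstract_complex_def)
  then have "0 < card \<sigma>" "card \<sigma> < card \<tau>"
    using assms(4) psubset_card_mono by (auto simp: card_gt_0_iff)
  then show ?thesis
    by (simp add: simplex_dim_def)
qed

text \<open>
  Being comparable with injective levels means that the levels are strictly ordered
  compatibly with inclusion; in this form adding a vertex is a check on pairs.
\<close>

lemma hat_inf_iff:
  "c \<in> hat_inf K \<longleftrightarrow> finite c \<and> c \<subseteq> face_poset K \<times> UNIV \<and>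
     (\<forall>u\<in>c. \<forall>v\<in>c. u = v \<or> fst u \<subseteq> fst v \<and> snd u < snd v \<or> fst v \<subseteq> fst u \<and> snd v < snd u)"
  (is "_ \<longleftrightarrow> _ \<and> _ \<and> (\<forall>u\<in>c. \<forall>v\<in>c. ?R u v)")
proof -
  have "?R u v \<longleftrightarrow> (u \<le> v \<or> v \<le> u) \<and> (snd u = snd v \<longrightarrow> u = v)" for u v
    by (cases u; cases v) auto
  then have "(\<forall>u\<in>c. \<forall>v\<in>c. ?R u v) \<longleftrightarrow> Complete_Partial_Order.chain (\<le>) c \<and> inj_on snd c"
    by (simp only:) (auto simp: chain_def inj_on_def)
  then show ?thesis
    by (auto simp: hat_inf_def order_complex_def)
qed

lemma hat_inf_subset: "c \<in> hat_inf K \<Longrightarrow> b \<subseteq> c \<Longrightarrow> b \<in> hat_inf K"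
  by (auto simp: hat_inf_def order_complex_def chain_def intro: finite_subset inj_on_subset)

text \<open>
  One stage shrinks the set \<open>P\<close> of admissible vertices to \<open>Q\<close> by moving the vertices outside \<open>Q\<close>, all
  of one dimension \<open>i\<close>, to level \<open>i\<close>. The last two conditions say that in a chain through a
  moved vertex \<open>(\<sigma>, j)\<close> the level \<open>i\<close> separates the smaller simplexes from the larger ones, which
  leaves room for \<open>(\<sigma>, i)\<close>. The condition \<open>k < j\<close> in \<open>below\<close> matters when vertices are raised: then nothing
  else bounds the levels of smaller simplexes.
\<close>

locale settling_stage =
  fixes P Q :: "('v set \<times> nat) set" and i :: nat
  assumes subset: "Q \<subseteq> P"
    and dim: "\<And>\<sigma> j. (\<sigma>, j) \<in> P - Q \<Longrightarrow> simplex_dim \<sigma> = i"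
    and settled: "\<And>\<sigma>. simplex_dim \<sigma> = i \<Longrightarrow> (\<sigma>, i) \<in> Q"
    and below: "\<And>\<sigma> \<tau> j k. \<lbrakk>(\<sigma>, j) \<in> P - Q; (\<tau>, k) \<in> P; simplex_dim \<tau> < i; k < j\<rbrakk> \<Longrightarrow> k < i"
    and above: "\<And>\<tau> k. \<lbrakk>(\<tau>, k) \<in> P; i < simplex_dim \<tau>\<rbrakk> \<Longrightarrow> i < k"
begin

lemma settle_eq: "v \<in> P - Q \<Longrightarrow> settle Q v = (fst v, i)"
  using dim[of "fst v" "snd v"] by (auto simp: settle_def dim_vertex_def)

lemma settle_mem: "v \<in> P \<Longrightarrow> settle Q v \<in> Q"
  using dim[of "fst v" "snd v"] settled[of "fst v"] by (auto simp: settle_def dim_vertex_def)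

text \<open>
  Two vertices of a chain that are both moved have the same dimension, hence the same simplex, and so
  the same image. A moved vertex fits with the old ones by the separation conditions of the locale.
\<close>

lemma contiguous:
  assumes K: "abstract_complex K" and c: "c \<in> hat_on K P"
  shows "c \<union> settle Q ` c \<in> hat_on K P"
proof -
  let ?R = "\<lambda>u v :: 'v set \<times> nat. u = v \<or> fst u \<subseteq> fst v \<and> snd u < snd v
                                   \<or> fst v \<subseteq> fst u \<and> snd v < snd u"
  have fin: "finite c" and faces: "c \<subseteq> face_poset K \<times> UNIV" and chain: "\<forall>u\<in>c. \<forall>v\<in>c. ?R u v"
    and cP: "c \<subseteq> P"
    using c by (auto simp: hat_on_def hat_inf_iff)
  have dim_less: "simplex_dim (fst u) < simplex_dim (fst v)"
    if "u \<in> c" "v \<in> c" "fst u \<subset> fst v" for u v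
  proof (rule simplex_dim_strict_mono[OF K _ _ that(3)])
    show "fst u \<in> face_poset K" "fst v \<in> face_poset K"
      using that faces by auto
  qed
  have moved_old: "?R (settle Q u) v" if u: "u \<in> c - Q" and v: "v \<in> c" for u v
  proof -
    have uPQ: "(fst u, snd u) \<in> P - Q" "(fst v, snd v) \<in> P"
      using u v cP by auto
    have dim_u: "simplex_dim (fst u) = i"
      using dim uPQ(1) by blast
    have "?R (fst u, i) v"
    proof (cases "fst u = fst v")
      case True
      then show ?thesis
        using prod.collapse[of v] by (metis fst_conv linorder_neqE_nat order_refl snd_conv)
    next
      case False
      moreover have "?R u v"
        using chain u v by blast
      ultimately consider "fst u \<subset> fst v" "snd u < snd v" | "fst v \<subset> fst u" "snd v < snd u"
        by (metis psubsetI)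
      then show ?thesis
      proof cases
        case 1
        then have "i < snd v"
          using dim_less[OF _ v 1(1)] u above[OF uPQ(2)] dim_u by simp
        with 1 show ?thesis
          by (simp add: less_imp_le)
      next
        case 2
        then have "snd v < i"
          using dim_less[OF v _ 2(1)] u below[OF uPQ] dim_u by simp
        with 2 show ?thesis
          by (simp add: less_imp_le)
      qed
    qed
    then show ?thesis
      using settle_eq[of u] uPQ by simp
  qed
  have moved_moved: "settle Q u = settle Q v" if u: "u \<in> c - Q" and v: "v \<in> c - Q" for u v
  proof -
    have "simplex_dim (fst u) = i" "simplex_dim (fst v) = i"
      using dim[of "fst u" "snd u"] dim[of "fst v" "snd v"] u v cP by auto
    then have "\<not> fst u \<subset> fst v" "\<not> fst v \<subset> fst u"
      using dim_less[of u v] dim_less[of v u] u v by auto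
    moreover have "?R u v"
      using chain u v by blast
    ultimately have "fst u = fst v"
      by (metis psubsetI)
    moreover have "u \<in> P - Q" "v \<in> P - Q"
      using u v cP by auto
    ultimately show ?thesis
      by (simp add: settle_eq)
  qed
  have sym: "?R v u" if "?R u v" for u v
    using that by argo
  have cases: "w \<in> c \<or> (\<exists>u\<in>c - Q. w = settle Q u)" if "w \<in> c \<union> settle Q ` c" for w
    using that by (auto simp: settle_def)
  have "?R u v" if "u \<in> c \<union> settle Q ` c" "v \<in> c \<union> settle Q ` c" for u v
    using cases[OF that(1)]
  proof
    assume u: "u \<in> c"
    show ?thesis
      using cases[OF that(2)]
    proof
      show "?R u v" if "v \<in> c"
        using chain u that by blast
      show "?R u v" if "\<exists>w\<in>c - Q. v = settle Q w"
        using that moved_old[OF _ u] sym by blast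
    qed
  next
    assume "\<exists>w\<in>c - Q. u = settle Q w"
    then obtain w where w: "w \<in> c - Q" "u = settle Q w"
      by blast
    show ?thesis
      using cases[OF that(2)]
    proof
      show "?R u v" if "v \<in> c"
        using moved_old[OF w(1) that] w(2) by simp
      show "?R u v" if "\<exists>w\<in>c - Q. v = settle Q w"
        using that moved_moved[OF w(1)] w(2) by auto
    qed
  qed
  moreover have "settle Q ` c \<subseteq> face_poset K \<times> UNIV"
    using faces by (auto simp: settle_def dim_vertex_def)
  moreover have "settle Q ` c \<subseteq> P"
    using settle_mem cP subset by blast
  ultimately show ?thesis
    using fin faces cP unfolding hat_on_def mem_Collect_eq hat_inf_iff
    by (intro conjI ballI Un_least finite_UnI finite_imageI)
qed

text \<open>
  The new vertices have level \<open>dim \<sigma>\<close> with \<open>\<sigma> \<in> L\<close>; this is where \<open>dim L \<le> n\<close> enters.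
\<close>

lemma contiguous_hat:
  assumes L: "abstract_complex L" "dim_at_most L n" and c: "c \<in> hat L n \<inter> hat_on K P"
  shows "c \<union> settle Q ` c \<in> hat L n"
proof -
  have "c \<in> hat_on L P" and cn: "c \<subseteq> face_poset L \<times> {0..n}"
    using c by (auto simp: hat_def hat_on_def)
  then have "c \<union> settle Q ` c \<in> hat_on L P"
    using contiguous L by blast
  moreover have "settle Q ` c \<subseteq> face_poset L \<times> {0..n}"
    using cn L(2) by (auto simp: settle_def dim_vertex_def dim_at_most_def)
  ultimately show ?thesis
    using cn by (simp add: hat_def hat_on_def)
qed

lemma deforms:
  assumes K: "abstract_complex K"
    and \<B>: "\<And>B. B \<in> \<B> \<Longrightarrow> \<exists>L n. abstract_complex L \<and> dim_at_most L n \<and> B = realization (hat L n)"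
  shows "deforms_within (realization_topology (hat_on K P)) (realization (hat_on K Q)) \<B>"
  unfolding deforms_within_def
proof (intro exI conjI ballI)
  show "strong_deformation_retraction (realization_topology (hat_on K P))
          (realization (hat_on K Q)) (linear_homotopy (settle Q))"
  proof (rule strong_deformation_retraction_linear_homotopy)
    show "abstract_complex (hat_on K P)" "subcomplex (hat_on K Q) (hat_on K P)"
      using abstract_complex_hat_on[of K] subset by (auto simp: subcomplex_def hat_on_def)
    show cont: "c \<union> settle Q ` c \<in> hat_on K P" if "c \<in> hat_on K P" for c
      by (rule contiguous[OF K that])
    show "settle Q ` c \<in> hat_on K Q" if "c \<in> hat_on K P" for c
      using cont[OF that] that settle_mem hat_inf_subset[of "c \<union> settle Q ` c" K "settle Q ` c"]
      by (auto simp: hat_on_def)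
    show "settle Q v = v" if "c \<in> hat_on K Q" "v \<in> c" for c v
      using that by (auto simp: hat_on_def settle_def)
  qed
next
  fix B assume "B \<in> \<B>"
  then obtain L n where L: "abstract_complex L" "dim_at_most L n" and B: "B = realization (hat L n)"
    using \<B> by blast
  let ?M = "hat L n \<inter> hat_on K P"
  have M: "abstract_complex ?M"
    using subcomplex_hat[of L L n] L(1)
    by (intro abstract_complex_Int abstract_complex_hat_on) (simp add: subcomplex_def)
  have "c \<union> settle Q ` c \<in> ?M" if "c \<in> ?M" for c
    using contiguous_hat[OF L that] contiguous[OF K] that by simp
  then have "moves_within_itself (linear_homotopy (settle Q)) (realization ?M)"
    using linear_homotopy_in_realization[OF M] by (simp add: moves_within_itself_def)
  then show "moves_within_itself (linear_homotopy (settle Q))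
      (B \<inter> topspace (realization_topology (hat_on K P)))"
    by (simp add: B realization_Int topspace_realization_topology abstract_complex_hat_on)
qed

end

section \<open>Raising and lowering the levels\<close>

text \<open>
  These are the vertices that remain after the dimensions \<open>\<ge> i\<close> have been raised, and then after the
  dimensions \<open>< i\<close> have been lowered. Raising ends at \<open>raised_from 0\<close>, which equals \<open>lowered_below 0\<close>, where
  lowering begins.
\<close>

definition raised_from :: "nat \<Rightarrow> ('v set \<times> nat) set" where
  "raised_from i = {(\<sigma>, j). i \<le> simplex_dim \<sigma> \<longrightarrow> simplex_dim \<sigma> \<le> j}"

definition lowered_below :: "nat \<Rightarrow> ('v set \<times> nat) set" where
  "lowered_below i =
     {(\<sigma>, j). simplex_dim \<sigma> \<le> j \<and> (simplex_dim \<sigma> < i \<longrightarrow> j = simplex_dim \<sigma>)}"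

lemma raising_stage: "settling_stage (raised_from (Suc i)) (raised_from i) i"
  by unfold_locales (auto simp: raised_from_def)

lemma lowering_stage: "settling_stage (lowered_below i) (lowered_below (Suc i)) i"
  by unfold_locales (auto simp: lowered_below_def)

lemma deforms_within_hat_on_trans:
  assumes "Q \<subseteq> P"
    and "deforms_within (realization_topology (hat_on K P)) (realization (hat_on K Q)) \<B>"
    and "deforms_within (realization_topology (hat_on K Q)) A \<B>"
  shows "deforms_within (realization_topology (hat_on K P)) A \<B>"
proof -
  have "hat_on K Q \<subseteq> hat_on K P"
    using assms(1) by (auto simp: hat_on_def)
  then have "realization_topology (hat_on K Q)
      = subtopology (realization_topology (hat_on K P)) (realization (hat_on K Q))"
    by (rule realization_topology_subcomplex[OF abstract_complex_hat_on])
  then show ?thesis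
    using assms(2,3) deforms_within_trans by metis
qed

text \<open>
  After all stages every vertex is of the form \<open>(\<sigma>, dim \<sigma>)\<close>, and then the condition on levels
  is automatic because dimension is strictly monotone.
\<close>

lemma hat_on_lowered_below:
  assumes K: "abstract_complex K" and d: "dim_at_most K d"
  shows "hat_on K (lowered_below (Suc d)) = dim_embedding_image K"
proof (intro equalityI subsetI)
  fix c assume "c \<in> hat_on K (lowered_below (Suc d))"
  then have fin: "finite c" and faces: "c \<subseteq> face_poset K \<times> UNIV" and low: "c \<subseteq> lowered_below (Suc d)"
    and chain: "\<forall>u\<in>c. \<forall>v\<in>c. u = v \<or> fst u \<subseteq> fst v \<and> snd u < snd v
                                 \<or> fst v \<subseteq> fst u \<and> snd v < snd u"
    by (auto simp: hat_on_def hat_inf_iff)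
  have "dim_vertex (fst v) = v" if "v \<in> c" for v
  proof -
    have "fst v \<in> face_poset K"
      using faces that by auto
    then have "simplex_dim (fst v) < Suc d"
      using d by (simp add: dim_at_most_def less_Suc_eq_le)
    then show ?thesis
      using low that by (cases v) (auto simp: lowered_below_def dim_vertex_def)
  qed
  then have "c = dim_vertex ` fst ` c"
    by (simp add: image_image)
  moreover have "fst ` c \<in> barycentric K"
  proof -
    have "fst ` c \<subseteq> face_poset K"
      using faces by auto
    moreover have "Complete_Partial_Order.chain (\<le>) (fst ` c)"
      unfolding chain_def using chain by (metis (no_types, lifting) imageE order_refl)
    ultimately show ?thesis
      using fin by (simp add: barycentric_def order_complex_def)
  qed
  ultimately show "c \<in> dim_embedding_image K"
    by (auto simp: dim_embedding_image_def)
next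
  fix c assume c: "c \<in> dim_embedding_image K"
  then have "c \<in> hat_inf K"
    using subcomplex_dim_embedding_image[OF K] by (auto simp: subcomplex_def)
  moreover have "c \<subseteq> lowered_below (Suc d)"
    using c by (auto simp: dim_embedding_image_def dim_vertex_def lowered_below_def)
  ultimately show "c \<in> hat_on K (lowered_below (Suc d))"
    by (simp add: hat_on_def)
qed

lemma hat_on_raised_from:
  assumes "dim_at_most K d"
  shows "hat_on K (raised_from (Suc d)) = hat_inf K"
proof -
  have "c \<subseteq> raised_from (Suc d)" if "c \<in> hat_inf K" for c
    using that assms by (force simp: hat_inf_iff raised_from_def dim_at_most_def)
  then show ?thesis
    by (auto simp: hat_on_def)
qed

theorem theorem5p10:
  fixes K :: "'v set set"
  assumes "abstract_complex K"
    and "finite_dimensional K"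
  shows "\<exists>h. strong_deformation_retraction
               (realization_topology (hat_inf K)) (realization (dim_embedding_image K)) h \<and>
             (\<forall>n L. subcomplex L K \<and> dim_at_most L n \<longrightarrow>
                moves_within_itself h (realization (hat L n)))"
proof -
  obtain d where d: "dim_at_most K d"
    using assms(2) by (auto simp: finite_dimensional_def)
  define \<B> where "\<B> = {realization (hat L n) | L n. subcomplex L K \<and> dim_at_most L n}"
  let ?A = "realization (hat_on K (lowered_below (Suc d)))"
  have \<B>: "\<exists>L n. abstract_complex L \<and> dim_at_most L n \<and> B = realization (hat L n)" if "B \<in> \<B>" for B
    using that unfolding \<B>_def subcomplex_def by blast
  have lower: "deforms_within (realization_topology (hat_on K (lowered_below i))) ?A \<B>"
    if "i \<le> Suc d" for i
    using that
  proof (induction rule: inc_induct)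
    case base
    show ?case
      using deforms_within_refl[of "realization_topology (hat_on K (lowered_below (Suc d)))" \<B>]
      by (simp add: topspace_realization_topology abstract_complex_hat_on)
  next
    case (step i)
    interpret settling_stage "lowered_below i" "lowered_below (Suc i)" i
      by (rule lowering_stage)
    show ?case
      using deforms_within_hat_on_trans[OF subset deforms[OF assms(1) \<B>] step.IH] .
  qed
  have raise: "deforms_within (realization_topology (hat_on K (raised_from i))) ?A \<B>" for i
  proof (induction i)
    case 0
    have "raised_from 0 = (lowered_below 0 :: ('v set \<times> nat) set)"
      by (simp add: raised_from_def lowered_below_def)
    then show ?case
      using lower[of 0] by simp
  next
    case (Suc i)
    interpret settling_stage "raised_from (Suc i)" "raised_from i" i
      by (rule raising_stage)
    show ?case
      using deforms_within_hat_on_trans[OF subset deforms[OF assms(1) \<B>] Suc.IH] .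
  qed
  have "deforms_within (realization_topology (hat_inf K)) (realization (dim_embedding_image K)) \<B>"
    using raise[of "Suc d"] by (simp only: hat_on_raised_from[OF d] hat_on_lowered_below[OF assms(1) d])
  then obtain h where h: "strong_deformation_retraction
        (realization_topology (hat_inf K)) (realization (dim_embedding_image K)) h"
    and h_in: "\<And>B. B \<in> \<B> \<Longrightarrow> moves_within_itself h (B \<inter> realization (hat_inf K))"
    by (auto simp: deforms_within_def topspace_realization_topology[OF abstract_complex_hat_inf])
  have "moves_within_itself h (realization (hat L n))"
    if L: "subcomplex L K" "dim_at_most L n" for L n
  proof -
    have "realization (hat L n) \<subseteq> realization (hat_inf K)"
      using subcomplex_hat[OF L(1)] by (simp add: subcomplex_def realization_mono)
    moreover have "realization (hat L n) \<in> \<B>"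
      using L unfolding \<B>_def by blast
    ultimately show ?thesis
      using h_in[of "realization (hat L n)"] by (simp add: Int_absorb2)
  qed
  with h show ?thesis
    by blast
qed

end
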